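(* The function $b^*$ satisfies $b^*(m)=m-1+o\left(\frac1m\right)$ as $m\to+\infty$; that is, $\lim_{m\to+\infty} m\,\bigl(b^*(m)-m+1\bigr)=0$.
   Context: Consider the Bogdanov-Takens system $x'=y,\ y'=-m^2+by+x^2+xy$, with real parameters $m>0$ and $b$. Its critical points are $(m,0)$, a saddle, and $(-m,0)$. It is known that for every $m>0$ there is a unique real number $b^*(m)<m$ such that the system has a limit cycle (which is then unique, hyperbolic and unstable) if and only if $b^*(m)<b<m$. For $b=b^*(m)$ the system has a saddle-loop, that is, a homoclinic connection of the saddle $(m,0)$ surrounding $(-m,0)$. The curve $b=b^*(m)$ is called the saddle-loop bifurcation curve. *)

theory Defs
  imports "HOL-Analysis.Analysis"
begin

definition BT_field :: "real \<Rightarrow> real \<Rightarrow> real \<times> real \<Rightarrow> real \<times> real" where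
  "BT_field m b = (\<lambda>(x, y). (y, - m\<^sup>2 + b * y + x\<^sup>2 + x * y))"

definition global_solution :: "(real \<times> real \<Rightarrow> real \<times> real) \<Rightarrow> (real \<Rightarrow> real \<times> real) \<Rightarrow> bool" where
  "global_solution F \<gamma> \<longleftrightarrow> (\<forall>t. (\<gamma> has_vector_derivative F (\<gamma> t)) (at t))"

text \<open>Equilibria are not counted as periodic orbits.\<close>

definition periodic_orbit :: "(real \<times> real \<Rightarrow> real \<times> real) \<Rightarrow> (real \<times> real) set \<Rightarrow> bool" where
  "periodic_orbit F \<Gamma> \<longleftrightarrow>
     (\<exists>\<gamma> T. global_solution F \<gamma> \<and> T > 0 \<and> (\<forall>t. \<gamma> (t + T) = \<gamma> t)
        \<and> \<not> \<gamma> constant_on UNIV \<and> \<Gamma> = range \<gamma>)"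

text \<open>A limit cycle is a periodic orbit that is isolated among all periodic orbits.\<close>

definition limit_cycle :: "(real \<times> real \<Rightarrow> real \<times> real) \<Rightarrow> (real \<times> real) set \<Rightarrow> bool" where
  "limit_cycle F \<Gamma> \<longleftrightarrow>
     periodic_orbit F \<Gamma> \<and>
     (\<exists>U. open U \<and> \<Gamma> \<subseteq> U \<and> (\<forall>\<Gamma>'. periodic_orbit F \<Gamma>' \<and> \<Gamma>' \<subseteq> U \<longrightarrow> \<Gamma>' = \<Gamma>))"

definition homoclinic_solution ::
  "(real \<times> real \<Rightarrow> real \<times> real) \<Rightarrow> real \<times> real \<Rightarrow> (real \<Rightarrow> real \<times> real) \<Rightarrow> bool" where
  "homoclinic_solution F p \<gamma> \<longleftrightarrow>
     global_solution F \<gamma> \<and> \<not> \<gamma> constant_on UNIV \<and>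
     (\<gamma> \<longlongrightarrow> p) at_top \<and> (\<gamma> \<longlongrightarrow> p) at_bot"

text \<open>The equilibrium \<open>(m, 0)\<close> is a saddle because the linearization there has determinant
  \<open>- 2 * m < 0\<close>. The loop consists of the homoclinic orbit together with the saddle, and
  surrounding \<open>(- m, 0)\<close> means that this point lies in a bounded component of its complement.\<close>

definition BT_saddle_loop :: "real \<Rightarrow> real \<Rightarrow> bool" where
  "BT_saddle_loop m b \<longleftrightarrow>
     (\<exists>\<gamma>. homoclinic_solution (BT_field m b) (m, 0) \<gamma> \<and>
          (- m, 0) \<in> inside (insert (m, 0) (range \<gamma>)))"

end

(*
  Put z = x + y - m and \<beta> = b - m + 1. Along orbits z' = (x + m) z + \<beta> y, so for \<beta> = 0 the line
  z = 0 through the saddle is invariant. If \<beta> < 0, a half-plane bounded by the stable eigendirection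
  separates the two ends of a homoclinic orbit. If \<beta> > 0, the lower part of the orbit reaches
  x = - 2 m; on its way back to x = - m above the axis it is attracted by the line z = 0 and ends up
  within 3 m exp (- m / 6) of it. Unless \<beta> is exponentially small, the drift \<beta> y then pushes the
  orbit across the line, after which it cannot return to the saddle.
  Altogether 0 \<le> \<beta> \<le> 12 m exp (- m / 6) for large m.
*)

theory Submission
  imports Defs "HOL-Real_Asymp.Real_Asymp"
begin

section \<open>Barrier arguments on the line\<close>

text \<open>The level set of \<open>c\<close> in \<open>{a..b}\<close> is compact and nonempty, so
  it has a largest element; a later value at or below \<open>c\<close> would force a still later
  crossing.\<close>

lemma last_crossing:
  fixes f :: "real \<Rightarrow> real"
  assumes "continuous_on {a..b} f" "a \<le> b" "f a \<le> c" "c < f b"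
  obtains \<tau> where "a \<le> \<tau>" "\<tau> < b" "f \<tau> = c" "\<And>t. \<tau> < t \<Longrightarrow> t \<le> b \<Longrightarrow> c < f t"
proof -
  define S where "S = {t \<in> {a..b}. f t = c}"
  have "closed S"
    unfolding S_def by (intro continuous_closed_preimage_constant assms(1)) auto
  moreover have "bounded S"
    by (rule bounded_subset[of "{a..b}"]) (auto simp: S_def)
  ultimately have "compact S" by (simp add: compact_eq_bounded_closed)
  moreover have "S \<noteq> {}"
    using IVT'[of f a c b] assms by (force simp: S_def)
  ultimately obtain \<tau> where \<tau>: "\<tau> \<in> S" "\<And>t. t \<in> S \<Longrightarrow> t \<le> \<tau>"
    by (meson compact_attains_sup)
  show thesis
  proof
    show "a \<le> \<tau>" "f \<tau> = c" using \<tau> by (auto simp: S_def)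
    show "\<tau> < b" using \<tau> assms by (cases "\<tau> = b") (auto simp: S_def)
    show "c < f t" if t: "\<tau> < t" "t \<le> b" for t
    proof (rule ccontr)
      assume "\<not> c < f t"
      moreover have "continuous_on {t..b} f"
        using assms(1) t \<open>a \<le> \<tau>\<close> by (auto intro: continuous_on_subset)
      ultimately obtain s where "t \<le> s" "s \<le> b" "f s = c"
        using IVT'[of f t c b] assms(4) t by force
      then show False using \<tau>(2)[of s] t \<open>a \<le> \<tau>\<close> by (auto simp: S_def)
    qed
  qed
qed

lemma first_crossing:
  fixes f :: "real \<Rightarrow> real"
  assumes "continuous_on {a..b} f" "a \<le> b" "f a < c" "c \<le> f b"
  obtains \<tau> where "a < \<tau>" "\<tau> \<le> b" "f \<tau> = c" "\<And>t. a \<le> t \<Longrightarrow> t < \<tau> \<Longrightarrow> f t < c"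
proof -
  have "continuous_on {-b..-a} (\<lambda>t. - f (- t))"
    by (intro continuous_intros continuous_on_compose2[OF assms(1)]) auto
  then obtain \<tau> where \<tau>: "-b \<le> \<tau>" "\<tau> < -a" "- f (- \<tau>) = - c"
    "\<And>t. \<tau> < t \<Longrightarrow> t \<le> -a \<Longrightarrow> - c < - f (- t)"
    by (rule last_crossing[where c = "- c"]) (use assms in auto)
  show thesis
  proof
    show "f t < c" if "a \<le> t" "t < - \<tau>" for t using \<tau>(4)[of "- t"] that by simp
  qed (use \<tau> in auto)
qed

text \<open>If \<open>f\<close> ended below \<open>c\<close>, it would stay below after its last
  visit to the level, yet the positive derivative there lifts it above.\<close>

lemma barrier_transversal:
  fixes f f' :: "real \<Rightarrow> real"
  assumes "\<And>t. (f has_real_derivative f' t) (at t)" "a \<le> b" "c \<le> f a"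
    and "\<And>t. a \<le> t \<Longrightarrow> t \<le> b \<Longrightarrow> f t = c \<Longrightarrow> 0 < f' t"
  shows "c \<le> f b"
proof (rule ccontr)
  assume "\<not> c \<le> f b"
  moreover have "continuous_on {a..b} (\<lambda>t. - f t)"
    using assms(1) by (intro continuous_intros DERIV_continuous_on) (auto intro: has_field_derivative_at_within)
  ultimately obtain \<tau> where \<tau>: "a \<le> \<tau>" "\<tau> < b" "- f \<tau> = - c"
    "\<And>t. \<tau> < t \<Longrightarrow> t \<le> b \<Longrightarrow> - c < - f t"
    by (rule_tac last_crossing[where c = "- c" and a = a and b = b]) (use assms in auto)
  obtain d where d: "d > 0" "\<And>h. 0 < h \<Longrightarrow> h < d \<Longrightarrow> f \<tau> < f (\<tau> + h)"
    using DERIV_pos_inc_right[OF assms(1) assms(4)] \<tau> by force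
  define h where "h = min (d / 2) (b - \<tau>)"
  have "0 < h" "h < d" "\<tau> + h \<le> b" using \<tau>(2) d(1) by (auto simp: h_def)
  then show False using d(2)[of h] \<tau>(3) \<tau>(4)[of "\<tau> + h"] by simp
qed

text \<open>Companion for a derivative of weak sign, known throughout the region below
  \<open>c\<close>: after its last visit to the level \<open>f\<close> cannot decrease.\<close>

lemma barrier_monotone:
  fixes f f' :: "real \<Rightarrow> real"
  assumes "\<And>t. (f has_real_derivative f' t) (at t)" "a \<le> b" "c \<le> f a"
    and "\<And>t. a \<le> t \<Longrightarrow> t \<le> b \<Longrightarrow> f t < c \<Longrightarrow> 0 \<le> f' t"
  shows "c \<le> f b"
proof (rule ccontr)
  assume *: "\<not> c \<le> f b"
  have cont: "continuous_on S f" for S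
    using assms(1) by (intro DERIV_continuous_on) (auto intro: has_field_derivative_at_within)
  obtain \<tau> where \<tau>: "a \<le> \<tau>" "\<tau> < b" "- f \<tau> = - c"
    "\<And>t. \<tau> < t \<Longrightarrow> t \<le> b \<Longrightarrow> - c < - f t"
    by (rule last_crossing[where c = "- c" and a = a and b = b and f = "\<lambda>t. - f t"])
       (use assms * in \<open>auto intro!: continuous_intros cont\<close>)
  have "f \<tau> \<le> f b"
  proof (rule DERIV_nonneg_imp_increasing_open[where f = f])
    fix t assume "\<tau> < t" "t < b"
    then show "\<exists>y. DERIV f t :> y \<and> y \<ge> 0"
      using assms(1)[of t] assms(4)[of t] \<tau> by force
  qed (use \<tau> cont in auto)
  then show False using \<tau> * by simp
qed

section \<open>Homoclinic orbits in coordinates\<close>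

locale BT_homoclinic =
  fixes m b :: real and x y :: "real \<Rightarrow> real"
  assumes m_pos: "0 < m"
    and dx: "(x has_real_derivative y t) (at t)"
    and dy: "(y has_real_derivative - m\<^sup>2 + b * y t + (x t)\<^sup>2 + x t * y t) (at t)"
    and x_top: "(x \<longlongrightarrow> m) at_top" and x_bot: "(x \<longlongrightarrow> m) at_bot"
    and y_top: "(y \<longlongrightarrow> 0) at_top" and y_bot: "(y \<longlongrightarrow> 0) at_bot"
    and nonconst: "\<exists>t. (x t, y t) \<noteq> (m, 0)"
begin

lemma continuous_x: "continuous_on S x"
  using dx by (intro DERIV_continuous_on) (auto intro: has_field_derivative_at_within)

lemma continuous_y: "continuous_on S y"
  using dy by (intro DERIV_continuous_on) (auto intro: has_field_derivative_at_within)

text \<open>Uniqueness of solutions by a Gronwall estimate: the squared distance \<open>g\<close> to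
  the saddle satisfies |g'| <= C g between \<open>t0\<close> and \<open>t\<close>, so a zero at
  \<open>t0\<close> forces a zero at \<open>t\<close>.\<close>

lemma not_saddle: "(x t0, y t0) \<noteq> (m, 0)"
proof
  assume t0: "(x t0, y t0) = (m, 0)"
  obtain t where t: "(x t, y t) \<noteq> (m, 0)" using nonconst by blast
  define g where "g = (\<lambda>s. (x s - m)\<^sup>2 + (y s)\<^sup>2)"
  define g' where "g' = (\<lambda>s. 2 * (x s - m) * y s * (1 + x s + m) + 2 * (b + x s) * (y s)\<^sup>2)"
  have dg: "(g has_real_derivative g' s) (at s)" for s
    unfolding g_def g'_def
    by (auto intro!: derivative_eq_intros dx dy simp: algebra_simps power2_eq_square)
  define I where "I = {min t t0..max t t0}"
  have "compact ((\<lambda>s. \<bar>1 + x s + m\<bar> + 2 * \<bar>b + x s\<bar>) ` I)"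
    unfolding I_def by (intro compact_continuous_image continuous_intros continuous_x) auto
  from compact_imp_bounded[OF this]
  obtain C where "\<forall>s\<in>I. norm (\<bar>1 + x s + m\<bar> + 2 * \<bar>b + x s\<bar>) \<le> C"
    by (auto simp only: bounded_iff ball_simps)
  then have C: "\<bar>1 + x s + m\<bar> + 2 * \<bar>b + x s\<bar> \<le> C" if "s \<in> I" for s
    using that by (auto dest!: bspec)
  have bound: "\<bar>g' s\<bar> \<le> C * g s" if "s \<in> I" for s
  proof -
    have "\<bar>2 * (x s - m) * y s\<bar> \<le> g s"
      using sum_squares_bound[of "x s - m" "y s"] sum_squares_bound[of "- (x s - m)" "y s"]
      unfolding g_def abs_le_iff by (simp add: power2_eq_square algebra_simps)
    then have "\<bar>2 * (x s - m) * y s * (1 + x s + m)\<bar> \<le> g s * \<bar>1 + x s + m\<bar>"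
      unfolding abs_mult[of "2 * (x s - m) * y s"] by (rule mult_right_mono) simp
    moreover have "\<bar>2 * (b + x s) * (y s)\<^sup>2\<bar> \<le> 2 * \<bar>b + x s\<bar> * g s"
      unfolding abs_mult g_def by (intro mult_mono) auto
    ultimately have "\<bar>g' s\<bar> \<le> (\<bar>1 + x s + m\<bar> + 2 * \<bar>b + x s\<bar>) * g s"
      unfolding g'_def by (simp add: algebra_simps)
    also have "\<dots> \<le> C * g s" using C[OF that] by (intro mult_right_mono) (auto simp: g_def)
    finally show ?thesis .
  qed
  have "g t \<le> 0"
  proof (cases "t0 \<le> t")
    case True
    have "- g t * exp (- C * t) \<ge> - g t0 * exp (- C * t0)"
    proof (rule DERIV_nonneg_imp_nondecreasing[OF True, where f = "\<lambda>s. - g s * exp (- C * s)"])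
      fix s assume "t0 \<le> s" "s \<le> t"
      then have "g' s \<le> C * g s" using bound[of s] by (auto simp: I_def)
      moreover have "((\<lambda>s. - g s * exp (- C * s)) has_real_derivative (C * g s - g' s) * exp (- C * s)) (at s)"
        by (rule derivative_eq_intros dg refl | simp)+ (simp add: algebra_simps)
      ultimately show "\<exists>d. ((\<lambda>s. - g s * exp (- C * s)) has_real_derivative d) (at s) \<and> 0 \<le> d"
        by (intro exI conjI) auto
    qed
    moreover have "g t0 = 0" using t0 by (simp add: g_def)
    ultimately have "g t * exp (- C * t) \<le> 0" by simp
    then show ?thesis by (simp add: mult_le_0_iff)
  next
    case False
    then have le: "t \<le> t0" by simp
    have "g t * exp (C * t) \<le> g t0 * exp (C * t0)"
    proof (rule DERIV_nonneg_imp_nondecreasing[OF le, where f = "\<lambda>s. g s * exp (C * s)"])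
      fix s assume "t \<le> s" "s \<le> t0"
      then have "- g' s \<le> C * g s" using bound[of s] by (auto simp: I_def)
      moreover have "((\<lambda>s. g s * exp (C * s)) has_real_derivative (C * g s + g' s) * exp (C * s)) (at s)"
        by (rule derivative_eq_intros dg refl | simp)+ (simp add: algebra_simps)
      ultimately show "\<exists>d. ((\<lambda>s. g s * exp (C * s)) has_real_derivative d) (at s) \<and> 0 \<le> d"
        by (intro exI conjI) auto
    qed
    moreover have "g t0 = 0" using t0 by (simp add: g_def)
    ultimately have "g t * exp (C * t) \<le> 0" by simp
    then show ?thesis by (simp add: mult_le_0_iff)
  qed
  then show False using t by (simp add: g_def sum_power2_le_zero_iff)
qed

text \<open>At a maximum of \<open>x\<close> one has \<open>y = 0\<close> and \<open>x'' = x\<^sup>2 - m\<^sup>2\<close>, which is positive for \<open>x > m\<close>.\<close>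

lemma x_le: "x t \<le> m"
proof (rule ccontr)
  assume t: "\<not> x t \<le> m"
  \<comment> \<open>Both tails lie below \<open>x t\<close>, so the maximum over a compact interval
    is global.\<close>
  have "eventually (\<lambda>s. x s < x t) at_top" "eventually (\<lambda>s. x s < x t) at_bot"
    using t order_tendstoD(2)[OF x_top] order_tendstoD(2)[OF x_bot] by auto
  then obtain A B where AB: "\<And>s. s \<ge> B \<Longrightarrow> x s < x t" "\<And>s. s \<le> A \<Longrightarrow> x s < x t"
    by (auto simp: eventually_at_top_linorder eventually_at_bot_linorder)
  have tAB: "A \<le> t" "t \<le> B" using AB(1)[of t] AB(2)[of t] by force+
  obtain \<tau> where \<tau>: "\<tau> \<in> {A..B}" "\<And>s. s \<in> {A..B} \<Longrightarrow> x s \<le> x \<tau>"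
    using continuous_attains_sup[of "{A..B}" x] continuous_x tAB by force
  have max: "x s \<le> x \<tau>" for s
    using \<tau>(2)[of s] \<tau>(2)[of t] AB(1)[of s] AB(2)[of s] tAB by (cases "s \<in> {A..B}") force+
  have y0: "y \<tau> = 0"
    using DERIV_local_max[OF dx, of 1] max by auto
  have "m\<^sup>2 < (x \<tau>)\<^sup>2" using max[of t] t m_pos by (intro power_strict_mono) auto
  then obtain d where d: "d > 0" "\<And>h. 0 < h \<Longrightarrow> h < d \<Longrightarrow> y \<tau> < y (\<tau> + h)"
    using DERIV_pos_inc_right[OF dy, of \<tau>] y0 by force
  have "x \<tau> < x (\<tau> + d / 2)"
  proof (rule DERIV_pos_imp_increasing_open[where f = x])
    fix s assume "\<tau> < s" "s < \<tau> + d / 2"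
    then show "\<exists>y. DERIV x s :> y \<and> y > 0" using dx d(2)[of "s - \<tau>"] y0 d(1) by auto
  qed (use d continuous_x in auto)
  then show False using max[of "\<tau> + d / 2"] by simp
qed

text \<open>Touching \<open>m\<close> would be a maximum of \<open>x\<close>, hence
  \<open>y = 0\<close> there, and the orbit would pass through the saddle.\<close>

lemma x_less: "x t < m"
proof -
  have "x t \<noteq> m"
  proof
    assume "x t = m"
    moreover from this have "y t = 0" using DERIV_local_max[OF dx, of 1] x_le by auto
    ultimately show False using not_saddle[of t] by simp
  qed
  then show ?thesis using x_le[of t] by simp
qed

lemma square_less: "- m < x t \<Longrightarrow> (x t)\<^sup>2 < m\<^sup>2"
  using x_less[of t] by (simp add: abs_square_less_1 abs_less_iff power2_strict_mono)

text \<open>Where -m < x < m the axis is crossed downwards only. So \<open>y t \<ge> 0\<close> at an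
  early time would persist backwards; \<open>x\<close> would then have increased from its limit
  \<open>m\<close>, contradicting \<open>x_less\<close>.\<close>

lemma leaves_below: obtains T where "\<And>t. t \<le> T \<Longrightarrow> - m < x t" "\<And>t. t \<le> T \<Longrightarrow> y t < 0"
proof -
  have "eventually (\<lambda>s. - m < x s) at_bot"
    using order_tendstoD(1)[OF x_bot] m_pos by auto
  then obtain T where T: "\<And>s. s \<le> T \<Longrightarrow> - m < x s" by (auto simp: eventually_at_bot_linorder)
  have "y t < 0" if "t \<le> T" for t
  proof (rule ccontr)
    assume t: "\<not> y t < 0"
    have y_nonneg: "0 \<le> y s" if "s \<le> t" for s
    proof -
      have "((\<lambda>s. y (- s)) has_real_derivative
          - (- m\<^sup>2 + b * y (- s) + (x (- s))\<^sup>2 + x (- s) * y (- s))) (at s)" for s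
        using dy[of "- s"] by (simp only: DERIV_mirror)
      then have "0 \<le> (\<lambda>s. y (- s)) (- s)"
        by (rule barrier_transversal[where a = "- t"]) (use that t \<open>t \<le> T\<close> T square_less in auto)
      then show ?thesis by simp
    qed
    have "x s \<le> x t" if "s \<le> t" for s
      by (rule DERIV_nonneg_imp_nondecreasing[OF that, where f = x]) (use dx y_nonneg in blast)
    then have "m \<le> x t"
      by (intro tendsto_upperbound[OF x_bot]) (auto intro: eventually_mono[OF eventually_le_at_bot])
    then show False using x_less[of t] by simp
  qed
  with T show thesis by (rule that)
qed

text \<open>Forward counterpart of \<open>leaves_below\<close>: a late \<open>y t \<le> 0\<close>
  would persist, and \<open>x\<close> would descend to its limit \<open>m\<close>.\<close>

lemma returns_above: obtains T where "\<And>t. T \<le> t \<Longrightarrow> 0 < y t"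
proof -
  have "eventually (\<lambda>s. - m < x s) at_top"
    using order_tendstoD(1)[OF x_top] m_pos by auto
  then obtain T where T: "\<And>s. s \<ge> T \<Longrightarrow> - m < x s" by (auto simp: eventually_at_top_linorder)
  have "0 < y t" if "T \<le> t" for t
  proof (rule ccontr)
    assume t: "\<not> 0 < y t"
    have y_nonpos: "y s \<le> 0" if "t \<le> s" for s
    proof -
      have "0 \<le> - y s"
        by (rule barrier_transversal[OF DERIV_minus[OF dy] that])
           (use t \<open>T \<le> t\<close> T square_less in auto)
      then show ?thesis by simp
    qed
    have "x s \<le> x t" if "t \<le> s" for s
      by (rule DERIV_nonpos_imp_nonincreasing[OF that, where f = x]) (use dx y_nonpos in blast)
    then have "m \<le> x t"
      by (intro tendsto_upperbound[OF x_top]) (auto intro: eventually_mono[OF eventually_ge_at_top])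
    then show False using x_less[of t] by simp
  qed
  then show thesis by (rule that)
qed

section \<open>The lower bound\<close>

text \<open>If \<open>b < m - 1\<close>, the orbit crosses the stable eigenline \<open>w = 0\<close>
  only towards negative \<open>w\<close>. It starts with \<open>w < 0\<close>, and near the saddle
  \<open>w\<close> keeps decreasing, so it cannot tend to 0.\<close>

lemma lower_bound: "m - 1 \<le> b"
proof (rule ccontr)
  assume b: "\<not> m - 1 \<le> b"
  define r where "r = sqrt ((b + m)\<^sup>2 + 8 * m)"
  \<comment> \<open>The negative eigenvalue of the linearization at the saddle.\<close>
  define l where "l = (b + m - r) / 2"
  have r2: "r\<^sup>2 = (b + m)\<^sup>2 + 8 * m" unfolding r_def using m_pos by simp
  have l2: "l\<^sup>2 = (b + m) * l + 2 * m"
    using r2 by (simp add: l_def power2_eq_square field_simps)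
  have r_gt: "\<bar>b + m\<bar> < r"
    unfolding r_def using m_pos by (intro real_less_rsqrt) simp
  \<comment> \<open>Comparing squares turns \<open>b < m - 1\<close> into \<open>l < -1\<close>,
    which fixes the sign of the quadratic term of \<open>w'\<close>.\<close>
  have "(b + m + 2)\<^sup>2 = (b + m)\<^sup>2 + 4 * (b + m) + 4"
    by (simp add: power2_eq_square algebra_simps)
  then have "(b + m + 2)\<^sup>2 < r\<^sup>2" using b r2 by simp
  then have "b + m + 2 < r" by (rule power2_less_imp_less) (use r_gt in linarith)
  then have l: "l < -1" by (simp add: l_def)
  define w where "w = (\<lambda>t. y t - l * (x t - m))"
  define w' where "w' = (\<lambda>t. (b - l + x t) * w t + (1 + l) * (x t - m)\<^sup>2)"
  have dw: "(w has_real_derivative w' t) (at t)" for t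
  proof -
    have "w' t = - m\<^sup>2 + b * y t + (x t)\<^sup>2 + x t * y t - l * y t + (x t - m) * (l\<^sup>2 - (b + m) * l - 2 * m)"
      by (simp add: w'_def w_def power2_eq_square algebra_simps)
    then have "w' t = - m\<^sup>2 + b * y t + (x t)\<^sup>2 + x t * y t - l * y t" using l2 by simp
    then show ?thesis
      unfolding w_def by (auto intro!: derivative_eq_intros dx dy)
  qed
  have neg: "(1 + l) * (x t - m)\<^sup>2 < 0" for t
    using l x_less[of t] by (auto simp: mult_neg_pos)
  obtain T where T: "\<And>t. t \<le> T \<Longrightarrow> y t < 0" using leaves_below by blast
  have w_nonpos: "w t \<le> 0" if "T \<le> t" for t
  proof -
    have "0 \<le> - w t"
    proof (rule barrier_transversal[OF _ that, where f = "\<lambda>t. - w t"])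
      show "((\<lambda>t. - w t) has_real_derivative - w' s) (at s)" for s by (intro DERIV_minus dw)
      show "0 \<le> - w T"
        using T[of T] x_less[of T] l mult_neg_neg[of l "x T - m"] by (simp add: w_def)
      show "0 < - w' s" if "- w s = 0" for s using neg[of s] that by (simp add: w'_def)
    qed
    then show ?thesis by simp
  qed
  have "- (b + m) < r" using r_gt by linarith
  \<comment> \<open>The limit \<open>b - l + m\<close> of the coefficient of \<open>w\<close> is the
    other eigenvalue, which is positive.\<close>
  then have "l - b < m" by (simp add: l_def field_simps)
  then have "eventually (\<lambda>s. l - b < x s) at_top" by (rule order_tendstoD(1)[OF x_top])
  then obtain S where S: "\<And>s. s \<ge> S \<Longrightarrow> l - b < x s" by (auto simp: eventually_at_top_linorder)
  define R where "R = max S T"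
  have w'_neg: "w' t < 0" if "R \<le> t" for t
    using mult_nonneg_nonpos[of "b - l + x t" "w t"] S[of t] w_nonpos[of t] neg[of t] that
    by (simp add: w'_def R_def)
  have "(w \<longlongrightarrow> 0 - l * (m - m)) at_top"
    unfolding w_def by (intro tendsto_intros x_top y_top)
  then have "0 - l * (m - m) < w R"
    by (rule DERIV_neg_imp_decreasing_at_top[rotated]) (use dw w'_neg in blast)
  then show False using w_nonpos[of R] by (simp add: R_def)
qed

section \<open>The upper bound\<close>

text \<open>The function \<open>y - (x + b)\<^sup>2 / 2\<close> has derivative \<open>x\<^sup>2 - m\<^sup>2\<close> along orbits; the term \<open>12 * x\<close>
  compensates for the sign change of this derivative at \<open>x = - m\<close>.\<close>

lemma reaches_far_left:
  assumes m: "40 \<le> m" and b: "b < m"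
  obtains t where "x t \<le> - 2 * m"
proof (rule ccontr)
  assume "\<not> thesis"
  then have x_gt: "- 2 * m < x t" for t using that[of t] by force
  define Q where "Q = (\<lambda>t. y t - (x t + b)\<^sup>2 / 2 + 12 * x t)"
  define Q' where "Q' = (\<lambda>t. (x t)\<^sup>2 - m\<^sup>2 + 12 * y t)"
  \<comment> \<open>The value of \<open>Q\<close> at the saddle.\<close>
  define q where "q = 0 - (m + b)\<^sup>2 / 2 + 12 * m"
  have dQ: "(Q has_real_derivative Q' t) (at t)" for t
    unfolding Q_def Q'_def
    by (rule derivative_eq_intros dx dy refl | simp)+ (simp add: algebra_simps)
  have Q_bot: "(Q \<longlongrightarrow> q) at_bot"
    unfolding Q_def q_def by (intro tendsto_intros x_bot y_bot) auto
  \<comment> \<open>The region \<open>Q < q\<close> is a trap below the axis. For x <= -m the worst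
    case is 3 m^2 + 12 (26 m - m^2) = 312 m - 9 m^2, negative for \<open>m \<ge> 40\<close>.\<close>
  have below: "y t < 0 \<and> Q' t < 0" if "Q t < q" for t
  proof -
    have "y t < (x t - m) * ((x t + m + 2 * b) / 2 - 12)"
      using that by (simp add: Q_def q_def power2_eq_square field_simps)
    also have "(x t - m) * ((x t + m + 2 * b) / 2 - 12) \<le> (x t - m) * (m / 2 - 13)"
    proof (rule mult_left_mono_neg)
      show "m / 2 - 13 \<le> (x t + m + 2 * b) / 2 - 12" using lower_bound x_gt[of t] by argo
    qed (use x_less[of t] in simp)
    finally have y: "y t < (x t - m) * (m / 2 - 13)" .
    then have "y t < 0" using mult_neg_pos[of "x t - m" "m / 2 - 13"] x_less[of t] m by simp
    moreover have "Q' t < 0"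
    proof (cases "- m < x t")
      case True
      then show ?thesis using square_less[of t] \<open>y t < 0\<close> by (simp add: Q'_def)
    next
      case False
      have "(x t - m) * (m / 2 - 13) \<le> (- 2 * m) * (m / 2 - 13)"
        using False m by (intro mult_right_mono) auto
      moreover have "(x t)\<^sup>2 \<le> (2 * m)\<^sup>2"
        using x_gt[of t] x_less[of t] m by (intro power2_le_iff_abs_le[THEN iffD2]) auto
      moreover have "(- 2 * m) * (m / 2 - 13) = 26 * m - m\<^sup>2" "(2 * m)\<^sup>2 = 4 * m\<^sup>2"
        by (simp_all add: power2_eq_square field_simps)
      moreover have "40 * m \<le> m\<^sup>2" using m by (simp add: power2_eq_square)
      ultimately show ?thesis using y m unfolding Q'_def by linarith
    qed
    ultimately show ?thesis by simp
  qed
  obtain T where T: "\<And>t. t \<le> T \<Longrightarrow> - m < x t" "\<And>t. t \<le> T \<Longrightarrow> y t < 0" using leaves_below by blast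
  have Q'_neg: "Q' t < 0" if "t \<le> T" for t
    using T[OF that] square_less[of t] by (simp add: Q'_def)
  \<comment> \<open>\<open>Q\<close> strictly decreases from its limit \<open>q\<close> at minus
    infinity, so the orbit enters the trap.\<close>
  have "- q < - Q T"
  proof (rule DERIV_pos_imp_increasing_at_bot[where f = "\<lambda>t. - Q t"])
    fix t assume "t \<le> T"
    then show "\<exists>d. ((\<lambda>t. - Q t) has_real_derivative d) (at t) \<and> 0 < d"
      using DERIV_minus[OF dQ[of t]] Q'_neg[of t] by force
  qed (intro tendsto_minus Q_bot)
  then have QT: "Q T < q" by simp
  have Q_le: "Q t \<le> Q T" if "T \<le> t" for t
  proof -
    have "- Q T \<le> - Q t"
      by (rule barrier_transversal[OF _ that, where f = "\<lambda>t. - Q t" and f' = "\<lambda>t. - Q' t"])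
         (use below QT in \<open>auto intro!: DERIV_minus dQ\<close>)
    then show ?thesis by simp
  qed
  obtain S where S: "\<And>t. S \<le> t \<Longrightarrow> 0 < y t" using returns_above by blast
  show False using S[of "max S T"] below[of "max S T"] Q_le[of "max S T"] QT by auto
qed

text \<open>Three barriers in succession: \<open>F\<close> bounds \<open>z\<close> below up to
  \<open>x = - m\<close>, a line of slope \<open>\<beta> / 2\<close> then carries \<open>z\<close>
  above 0, and a positive level \<open>c\<close> finally keeps \<open>z\<close> from tending to
  0.\<close>

lemma upper_bound:
  assumes m: "40 \<le> m" and b: "b < m"
  shows "b - m + 1 \<le> 12 * m * exp (- m / 6)"
proof (rule ccontr)
  define \<beta> where "\<beta> = b - m + 1"
  assume "\<not> ?thesis"
  then have \<beta>: "12 * m * exp (- m / 6) < \<beta>" by (simp add: \<beta>_def)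
  moreover have "0 < 12 * m * exp (- m / 6)" using m by simp
  ultimately have \<beta>0: "0 < \<beta>" by linarith
  have \<beta>1: "\<beta> < 1" using b by (simp add: \<beta>_def)
  define z where "z = (\<lambda>t. x t + y t - m)"
  define z' where "z' = (\<lambda>t. (x t + m) * z t + \<beta> * y t)"
  have dz: "(z has_real_derivative z' t) (at t)" for t
    unfolding z_def z'_def \<beta>_def
    by (rule derivative_eq_intros dx dy refl | simp)+ (simp add: algebra_simps power2_eq_square)

  obtain t0 where t0: "x t0 \<le> - 2 * m" using reaches_far_left[OF m b] .
  have "eventually (\<lambda>t. 0 < x t) at_top" using order_tendstoD(1)[OF x_top m_pos] .
  then have "eventually (\<lambda>t. 0 < x t \<and> t0 \<le> t) at_top"
    by (intro eventually_conj eventually_ge_at_top)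
  then obtain t4 where t4: "0 < x t4" "t0 \<le> t4" by (auto simp: eventually_at_top_linorder)
  \<comment> \<open>First arrival at \<open>- m\<close>, then the last earlier visit to
    \<open>- 2 * m\<close>: between these times \<open>x\<close> stays in the strip.\<close>
  obtain t3 where t3: "t0 < t3" "t3 \<le> t4" "x t3 = - m"
    and left: "\<And>t. t0 \<le> t \<Longrightarrow> t < t3 \<Longrightarrow> x t < - m"
    by (rule first_crossing[OF continuous_x t4(2), of "- m"]) (use t0 t4 m in auto)
  obtain t2 where t2: "t0 \<le> t2" "t2 < t3" "x t2 = - 2 * m"
    and right: "\<And>t. t2 < t \<Longrightarrow> t \<le> t3 \<Longrightarrow> - 2 * m < x t"
    by (rule last_crossing[OF continuous_x less_imp_le[OF t3(1)], of "- 2 * m"]) (use t0 t3 m in auto)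
  have x_bounds: "- 2 * m \<le> x t" "x t \<le> - m" if "t2 \<le> t" "t \<le> t3" for t
    using left[of t] right[of t] t2 t3 that by (cases "t = t2"; cases "t = t3"; force)+

  \<comment> \<open>Otherwise \<open>x\<close> would drop below \<open>- 2 * m\<close> right after
    \<open>t2\<close>.\<close>
  have "0 \<le> y t2"
  proof (rule ccontr)
    assume "\<not> 0 \<le> y t2"
    then obtain d where d: "d > 0" "\<And>h. 0 < h \<Longrightarrow> h < d \<Longrightarrow> x (t2 + h) < x t2"
      using DERIV_neg_dec_right[OF dx, of t2] by force
    define h where "h = min (d / 2) (t3 - t2)"
    have "0 < h" "h < d" "t2 + h \<le> t3" using t2(2) d(1) by (auto simp: h_def)
    then show False using d(2)[of h] right[of "t2 + h"] t2(3) by simp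
  qed
  have y_nonneg: "0 \<le> y t" if "t2 \<le> t" "t \<le> t3" for t
  proof (rule barrier_monotone[OF dy that(1) \<open>0 \<le> y t2\<close>])
    fix s assume s: "t2 \<le> s" "s \<le> t" "y s < 0"
    have "m\<^sup>2 \<le> (- x s)\<^sup>2" using x_bounds[of s] s that m by (intro power_mono) auto
    moreover have "0 \<le> (b + x s) * y s"
      using x_bounds[of s] s that b by (intro mult_nonpos_nonpos) auto
    ultimately show "0 \<le> - m\<^sup>2 + b * y s + (x s)\<^sup>2 + x s * y s" by (simp add: algebra_simps)
  qed

  \<comment> \<open>Integrating factor for z' = (x + m) z with dt = dx / y and the speed
    \<open>y\<close> replaced by its bound \<open>3 * m\<close>. It is \<open>exp (- m / 6)\<close>
    at \<open>t2\<close> and 1 at \<open>t3\<close>.\<close>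
  define e where "e = (\<lambda>t. exp (- (x t + m)\<^sup>2 / (6 * m)))"
  define F where "F = (\<lambda>t. z t * e t)"
  define F' where "F' = (\<lambda>t. ((x t + m) * z t * (1 - y t / (3 * m)) + \<beta> * y t) * e t)"
  have "((\<lambda>t. - (x t + m)\<^sup>2 / (6 * m)) has_real_derivative - ((x t + m) * y t / (3 * m))) (at t)" for t
    using m by (auto intro!: derivative_eq_intros dx simp: field_simps power2_eq_square)
  then have de: "(e has_real_derivative e t * - ((x t + m) * y t / (3 * m))) (at t)" for t
    unfolding e_def by (rule DERIV_fun_exp)
  have dF: "(F has_real_derivative F' t) (at t)" for t
  proof -
    have "z' t * e t + e t * - ((x t + m) * y t / (3 * m)) * z t = F' t"
      using m by (simp add: F'_def z'_def field_simps)
    then show ?thesis using DERIV_mult[OF dz[of t] de[of t]] by (simp add: F_def)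
  qed
  have "- 3 * m * exp (- m / 6) \<le> F t3"
  proof (rule barrier_monotone[OF dF less_imp_le[OF t2(2)]])
    have "e t2 = exp (- m / 6)" using t2 m by (simp add: e_def power2_eq_square)
    moreover have "- 3 * m \<le> z t2" using t2(3) \<open>0 \<le> y t2\<close> by (simp add: z_def)
    ultimately show "- 3 * m * exp (- m / 6) \<le> F t2"
      unfolding F_def by (metis exp_ge_zero mult_right_mono)
    \<comment> \<open>Below this level \<open>z < 0\<close>, so y = z + m - x <= 3m, and both terms
      of \<open>F'\<close> are nonnegative.\<close>
    fix s assume s: "t2 \<le> s" "s \<le> t3" "F s < - 3 * m * exp (- m / 6)"
    have "- 3 * m * exp (- m / 6) < 0" using m by simp
    then have "z s * e s < 0" using s unfolding F_def by linarith
    then have zs: "z s < 0" by (simp add: e_def mult_less_0_iff)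
    then have "y s \<le> 3 * m" using x_bounds[of s] s by (simp add: z_def)
    then have "0 \<le> 1 - y s / (3 * m)" using m by (simp add: field_simps)
    moreover have "0 \<le> (x s + m) * z s" using zs x_bounds[of s] s by (intro mult_nonpos_nonpos) auto
    ultimately have "0 \<le> (x s + m) * z s * (1 - y s / (3 * m))" by (rule mult_nonneg_nonneg[rotated])
    moreover have "0 \<le> \<beta> * y s" using y_nonneg[of s] s \<beta>0 by simp
    ultimately show "0 \<le> F' s" by (simp add: F'_def e_def)
  qed
  moreover have "F t3 = z t3" using t3 by (simp add: F_def e_def)
  \<comment> \<open>The constant 12 is 4 times 3: the deficit \<open>3 * m * exp (- m / 6)\<close>
    is less than \<open>\<beta> / 4\<close>.\<close>
  ultimately have z3: "- \<beta> / 4 \<le> z t3" using \<beta> by simp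

  \<comment> \<open>Half of the drift \<open>\<beta> * y\<close> moves the barrier along with
    \<open>x\<close>; the other half must outweigh \<open>(x + m) * z\<close>.\<close>
  have "- \<beta> / 4 \<le> z t4 - \<beta> / 2 * (x t4 + m)"
  proof (rule barrier_transversal[OF _ t3(2), where f = "\<lambda>t. z t - \<beta> / 2 * (x t + m)"])
    show "((\<lambda>t. z t - \<beta> / 2 * (x t + m)) has_real_derivative z' t - \<beta> / 2 * y t) (at t)" for t
      by (auto intro!: derivative_eq_intros dz dx)
    show "- \<beta> / 4 \<le> z t3 - \<beta> / 2 * (x t3 + m)" using z3 t3 by simp
    fix t assume K: "z t - \<beta> / 2 * (x t + m) = - \<beta> / 4"
    define s where "s = x t + m"
    have zs: "z t = \<beta> / 2 * s - \<beta> / 4" using K by (simp add: s_def)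
    have ys: "y t = 2 * m - s + z t" by (simp add: z_def s_def)
    have "s * (1 - \<beta> / 2) \<le> 2 * m * (1 - \<beta> / 2)"
      using x_less[of t] \<beta>1 by (intro mult_right_mono) (auto simp: s_def)
    then have "\<beta> * (m - 1 / 4) \<le> y t" by (simp add: ys zs algebra_simps)
    moreover have "\<beta> * 39 \<le> \<beta> * (m - 1 / 4)" using m \<beta>0 by (intro mult_left_mono) auto
    ultimately have y39: "\<beta> * 39 \<le> y t" by linarith
    have "z' t - \<beta> / 2 * y t = \<beta> * (s\<^sup>2 / 2 - s / 4 + y t / 2)"
      unfolding z'_def zs by (simp add: s_def power2_eq_square algebra_simps)
    moreover have "0 < s\<^sup>2 / 2 - s / 4 + y t / 2"
    \<comment> \<open>The term s^2/2 - s/4 is negative only for 0 < s < 1/2, where \<open>y\<close>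
      is large; elsewhere \<open>y > 0\<close> suffices. This includes \<open>s < 0\<close>, should
      the orbit recross \<open>x = - m\<close>.\<close>
    proof (cases "0 \<le> s \<and> s \<le> 1")
      case True
      then have "39 \<le> y t"
        using \<beta>0 \<beta>1 m mult_nonneg_nonneg[of \<beta> s] unfolding ys zs by linarith
      then show ?thesis using True zero_le_power2[of s] by linarith
    next
      case False
      then have "0 \<le> s * (2 * s - 1)" by (auto simp: zero_le_mult_iff)
      then have "0 \<le> s\<^sup>2 / 2 - s / 4" by (simp add: power2_eq_square algebra_simps)
      then show ?thesis using y39 \<beta>0 by simp
    qed
    ultimately show "0 < z' t - \<beta> / 2 * y t" using \<beta>0 by simp
  qed
  moreover have "\<beta> / 2 * m \<le> \<beta> / 2 * (x t4 + m)" using t4 \<beta>0 by (intro mult_left_mono) auto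
  moreover have "\<beta> / 2 * 1 \<le> \<beta> / 2 * m" using m \<beta>0 by (intro mult_left_mono) auto
  ultimately have z4: "0 < z t4" using \<beta>0 by linarith

  \<comment> \<open>Below \<open>\<beta>\<close>, so that (beta - c)(m - x) is positive on the
    level, and at most \<open>z t4\<close>, so that the orbit starts above it.\<close>
  define c where "c = min (\<beta> / 2) (z t4)"
  have c: "0 < c" "c < \<beta>" using \<beta>0 z4 by (auto simp: c_def)
  have "c \<le> z t" if "t4 \<le> t" for t
  proof (rule barrier_transversal[OF dz that])
    show "c \<le> z t4" by (simp add: c_def)
    fix s assume zs: "z s = c"
    have "z' s = (\<beta> - c) * (m - x s) + 2 * m * c + \<beta> * c"
    proof -
      have y: "y s = c + m - x s" using zs by (simp add: z_def)
      show ?thesis unfolding z'_def zs y by (simp add: algebra_simps)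
    qed
    then show "0 < z' s" using c \<beta>0 m x_less[of s] by (simp add: add_pos_pos)
  qed
  moreover have "(z \<longlongrightarrow> m + 0 - m) at_top" unfolding z_def by (intro tendsto_intros x_top y_top)
  ultimately have "c \<le> m + 0 - m"
    by (intro tendsto_lowerbound[where F = at_top]) (auto intro: eventually_mono[OF eventually_ge_at_top])
  then show False using c by simp
qed

end

section \<open>From planar saddle-loops to the asymptotics\<close>

lemma BT_homoclinicI:
  assumes "0 < m" "homoclinic_solution (BT_field m b) (m, 0) \<gamma>"
  shows "BT_homoclinic m b (fst \<circ> \<gamma>) (snd \<circ> \<gamma>)"
proof
  have d: "(\<gamma> has_vector_derivative BT_field m b (\<gamma> t)) (at t)" for t
    using assms(2) by (simp add: homoclinic_solution_def global_solution_def)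
  show "((fst \<circ> \<gamma>) has_real_derivative (snd \<circ> \<gamma>) t) (at t)" for t
    using bounded_linear.has_vector_derivative[OF bounded_linear_fst d[of t]]
    by (simp add: has_real_derivative_iff_has_vector_derivative BT_field_def split_beta o_def)
  show "((snd \<circ> \<gamma>) has_real_derivative
      - m\<^sup>2 + b * (snd \<circ> \<gamma>) t + ((fst \<circ> \<gamma>) t)\<^sup>2 + (fst \<circ> \<gamma>) t * (snd \<circ> \<gamma>) t) (at t)" for t
    using bounded_linear.has_vector_derivative[OF bounded_linear_snd d[of t]]
    by (simp add: has_real_derivative_iff_has_vector_derivative BT_field_def split_beta o_def)
  have lim: "(\<gamma> \<longlongrightarrow> (m, 0)) at_top" "(\<gamma> \<longlongrightarrow> (m, 0)) at_bot"
    using assms(2) by (auto simp: homoclinic_solution_def)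
  show "((fst \<circ> \<gamma>) \<longlongrightarrow> m) at_top" "((fst \<circ> \<gamma>) \<longlongrightarrow> m) at_bot"
    "((snd \<circ> \<gamma>) \<longlongrightarrow> 0) at_top" "((snd \<circ> \<gamma>) \<longlongrightarrow> 0) at_bot"
    using lim[THEN tendsto_fst] lim[THEN tendsto_snd] by (simp_all add: o_def)
  show "\<exists>t. ((fst \<circ> \<gamma>) t, (snd \<circ> \<gamma>) t) \<noteq> (m, 0)"
    using assms(2) by (auto simp: homoclinic_solution_def constant_on_def)
qed (fact assms)

theorem theorem1:
  fixes bstar :: "real \<Rightarrow> real"
  assumes "\<And>m. m > 0 \<Longrightarrow> bstar m < m"
    and "\<And>m b. m > 0 \<Longrightarrow>
           (\<exists>\<Gamma>. limit_cycle (BT_field m b) \<Gamma>) \<longleftrightarrow> bstar m < b \<and> b < m"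
    and "\<And>m. m > 0 \<Longrightarrow> BT_saddle_loop m (bstar m)"
  shows "((\<lambda>m. m * (bstar m - m + 1)) \<longlongrightarrow> 0) at_top"
proof (rule tendsto_sandwich)
  \<comment> \<open>The saddle-loop at \<open>bstar m\<close> supplies the orbit to which both
    bounds apply; the upper one is exponentially small, so it absorbs the factor
    \<open>m\<close>.\<close>
  have bounds: "0 \<le> bstar m - m + 1" "bstar m - m + 1 \<le> 12 * m * exp (- m / 6)" if "40 \<le> m" for m
  proof -
    have "0 < m" using that by simp
    then obtain \<gamma> where "homoclinic_solution (BT_field m (bstar m)) (m, 0) \<gamma>"
      using assms(3) by (auto simp: BT_saddle_loop_def)
    then interpret BT_homoclinic m "bstar m" "fst \<circ> \<gamma>" "snd \<circ> \<gamma>"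
      by (rule BT_homoclinicI[OF \<open>0 < m\<close>])
    show "0 \<le> bstar m - m + 1" "bstar m - m + 1 \<le> 12 * m * exp (- m / 6)"
      using lower_bound upper_bound that assms(1) \<open>0 < m\<close> by auto
  qed
  show "\<forall>\<^sub>F m in at_top. 0 \<le> m * (bstar m - m + 1)"
    using eventually_ge_at_top[of 40] by eventually_elim (use bounds in auto)
  show "\<forall>\<^sub>F m in at_top. m * (bstar m - m + 1) \<le> m * (12 * m * exp (- m / 6))"
    using eventually_ge_at_top[of 40] by eventually_elim (rule mult_left_mono[OF bounds(2)], auto)
  show "((\<lambda>m::real. m * (12 * m * exp (- m / 6))) \<longlongrightarrow> 0) at_top" by real_asymp
qed simp

end
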